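(* Let $Q=(Q,\bigvee,\circ,1)$ be a quantale whose underlying complete lattice is continuous, let $\mathbb{C}$ be a Cauchy-complete $Q$-category, and let $f:\mathbb{C}\to\mathbb{C}$ be a $\varphi$-contraction whose control function $\varphi:Q\to Q$ is sequentially lower-semicontinuous. If there exists an object $x\in\mathbb{C}_0$ such that $\mathbb{C}(x,fx)\neq 0\neq\mathbb{C}(fx,x)$, then $f$ has a fixpoint, namely the object $u\in\mathbb{C}_0$ representing the adjunction $\phi_{x,f}\dashv\psi_{x,f}$ (that is, $\phi_{x,f}\dashv\psi_{x,f}$ holds, and an object $u$ with $\phi_{x,f}=\mathbb{C}(-,u)$ and $\psi_{x,f}=\mathbb{C}(u,-)$ satisfies $fu\cong u$).
   Context: A quantale $Q=(Q,\bigvee,\circ,1)$ is a complete lattice with a monoid structure $(Q,\circ,1)$ such that $\circ$ distributes over arbitrary suprema in each variable; $1$ need not be the top element and $\circ$ need not be commutative; $0$ denotes the bottom element. A $Q$-category $\mathbb{C}$ is a set $\mathbb{C}_0$ with a map $\mathbb{C}_0\times\mathbb{C}_0\to Q$, $(x,y)\mapsto\mathbb{C}(x,y)$, such that $\mathbb{C}(x,y)\circ\mathbb{C}(y,z)\le\mathbb{C}(x,z)$ and $1\le\mathbb{C}(x,x)$ for all $x,y,z$. Objects $c,c'$ are isomorphic, $c\cong c'$, if $1\le\mathbb{C}(c,c')$ and $1\le\mathbb{C}(c',c)$. A presheaf (distributor from the one-object category with hom $1$ to $\mathbb{C}$) is a map $\phi:\mathbb{C}_0\to Q$ with $\mathbb{C}(y',y)\circ\phi(y)\le\phi(y')$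 for all $y,y'$; dually, a distributor from $\mathbb{C}$ to the one-object category is a map $\psi:\mathbb{C}_0\to Q$ with $\psi(y)\circ\mathbb{C}(y,y')\le\psi(y')$. One writes $\phi\dashv\psi$ ($\phi$ is left adjoint to $\psi$) if $1\le\bigvee_{y\in\mathbb{C}_0}\psi(y)\circ\phi(y)$ and $\phi(y)\circ\psi(y')\le\mathbb{C}(y,y')$ for all $y,y'$. $\mathbb{C}$ is Cauchy-complete if every left adjoint presheaf $\phi$ is representable, i.e. $\phi=\mathbb{C}(-,u)$ for some $u\in\mathbb{C}_0$ (its right adjoint is then $\mathbb{C}(u,-)$). Given maps $\varphi:Q\to Q$ and $f:\mathbb{C}_0\to\mathbb{C}_0$, $f$ is a $\varphi$-contraction, and $\varphi$ is a control function for $f$, if: (1) $\varphi(t)\ge t$ for all $t\in Q$; (2) if $\varphi(t)=t$ then $t=0$ or $1\le t$; (3) $\mathbb{C}(fx,fy)\ge\varphi(\mathbb{C}(x,y))$ for all $x,y\in\mathbb{C}_0$. A fixpoint of $f$ is an object $u$ with $fu\cong u$. For $x\in\mathbb{C}_0$ put $\phi_{x,f}(y)=\bigvee_{N\in\mathbb{N}}\bigwedge_{n\ge N}\mathbb{C}(y,f^nx)$ and $\psi_{x,f}(y)=\bigvee_{N\in\mathbb{N}}\bigwedge_{n\ge N}\mathbb{C}(f^nx,y)$; these are distributors of the two types above. A subset $D$ of a complete lattice $L$ is directed if it is non-empty and any two elements of $D$ have an upper bound in $D$. For $a,b\in L$, $a\ll b$ means: for every directed $D\subseteq L$ with $b\le\bigvee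 D$ there is $d\in D$ with $a\le d$. $L$ is continuous if $a=\bigvee\{u\in L\mid u\ll a\}$ for every $a\in L$. A map $\varphi:L\to M$ between complete lattices is sequentially lower-semicontinuous if for every sequence $(t_n)_{n\in\mathbb{N}}$ in $L$, $\varphi(\bigvee_{N}\bigwedge_{n\ge N}t_n)\le\bigvee_{N}\bigwedge_{n\ge N}\varphi(t_n)$. *)

theory Defs
  imports "HOL-Library.FuncSet"
begin

definition (in order) directed :: "'a set \<Rightarrow> bool" where
  "directed D \<longleftrightarrow> D \<noteq> {} \<and> (\<forall>a\<in>D. \<forall>b\<in>D. \<exists>c\<in>D. a \<le> c \<and> b \<le> c)"

definition (in complete_lattice) way_below :: "'a \<Rightarrow> 'a \<Rightarrow> bool" where
  "way_below a b \<longleftrightarrow> (\<forall>D. directed D \<longrightarrow> b \<le> Sup D \<longrightarrow> (\<exists>d\<in>D. a \<le> d))"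

class continuous_lattice = complete_lattice +
  assumes Sup_way_below: "a = Sup {u. way_below u a}"

definition seq_lower_semicontinuous :: "('a::complete_lattice \<Rightarrow> 'b::complete_lattice) \<Rightarrow> bool" where
  "seq_lower_semicontinuous \<phi> \<longleftrightarrow>
    (\<forall>t :: nat \<Rightarrow> 'a. \<phi> (SUP N. INF n\<in>{N..}. t n) \<le> (SUP N. INF n\<in>{N..}. \<phi> (t n)))"

text \<open>The bottom element, often written \<open>0\<close>, is \<open>bot\<close>. Distributivity includes the empty supremum, so \<open>bot\<close> is absorbing.\<close>

class quantale = complete_lattice + monoid_mult +
  assumes mult_Sup_distrib: "a * Sup B = Sup ((\<lambda>b. a * b) ` B)"
    and Sup_mult_distrib: "Sup B * a = Sup ((\<lambda>b. b * a) ` B)"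

record ('o, 'q) qcat =
  Ob :: "'o set"
  Hom :: "'o \<Rightarrow> 'o \<Rightarrow> 'q"

definition qcategory :: "('o, 'q::quantale) qcat \<Rightarrow> bool" where
  "qcategory C \<longleftrightarrow>
    (\<forall>x\<in>Ob C. \<forall>y\<in>Ob C. \<forall>z\<in>Ob C. Hom C x y * Hom C y z \<le> Hom C x z) \<and>
    (\<forall>x\<in>Ob C. 1 \<le> Hom C x x)"

definition qiso :: "('o, 'q::quantale) qcat \<Rightarrow> 'o \<Rightarrow> 'o \<Rightarrow> bool" where
  "qiso C x y \<longleftrightarrow> x \<in> Ob C \<and> y \<in> Ob C \<and> 1 \<le> Hom C x y \<and> 1 \<le> Hom C y x"

text \<open>Distributors between the one-object category with hom \<open>1\<close> and \<open>C\<close> are represented by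
  functions on the type of objects. Only their values on \<open>Ob C\<close> are relevant.\<close>

definition presheaf :: "('o, 'q::quantale) qcat \<Rightarrow> ('o \<Rightarrow> 'q) \<Rightarrow> bool" where
  "presheaf C \<phi> \<longleftrightarrow> (\<forall>y\<in>Ob C. \<forall>y'\<in>Ob C. Hom C y' y * \<phi> y \<le> \<phi> y')"

definition copresheaf :: "('o, 'q::quantale) qcat \<Rightarrow> ('o \<Rightarrow> 'q) \<Rightarrow> bool" where
  "copresheaf C \<psi> \<longleftrightarrow> (\<forall>y\<in>Ob C. \<forall>y'\<in>Ob C. \<psi> y * Hom C y y' \<le> \<psi> y')"

definition left_adjoint_to :: "('o, 'q::quantale) qcat \<Rightarrow> ('o \<Rightarrow> 'q) \<Rightarrow> ('o \<Rightarrow> 'q) \<Rightarrow> bool" where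
  "left_adjoint_to C \<phi> \<psi> \<longleftrightarrow>
    presheaf C \<phi> \<and> copresheaf C \<psi> \<and>
    1 \<le> (SUP y\<in>Ob C. \<psi> y * \<phi> y) \<and>
    (\<forall>y\<in>Ob C. \<forall>y'\<in>Ob C. \<phi> y * \<psi> y' \<le> Hom C y y')"

definition represents :: "('o, 'q::quantale) qcat \<Rightarrow> 'o \<Rightarrow> ('o \<Rightarrow> 'q) \<Rightarrow> bool" where
  "represents C u \<phi> \<longleftrightarrow> u \<in> Ob C \<and> (\<forall>y\<in>Ob C. \<phi> y = Hom C y u)"

definition corepresents :: "('o, 'q::quantale) qcat \<Rightarrow> 'o \<Rightarrow> ('o \<Rightarrow> 'q) \<Rightarrow> bool" where
  "corepresents C u \<psi> \<longleftrightarrow> u \<in> Ob C \<and> (\<forall>y\<in>Ob C. \<psi> y = Hom C u y)"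

definition Cauchy_complete_qcat :: "('o, 'q::quantale) qcat \<Rightarrow> bool" where
  "Cauchy_complete_qcat C \<longleftrightarrow>
    (\<forall>\<phi>. (\<exists>\<psi>. left_adjoint_to C \<phi> \<psi>) \<longrightarrow> (\<exists>u. represents C u \<phi>))"

definition contraction ::
    "('o, 'q::quantale) qcat \<Rightarrow> ('q \<Rightarrow> 'q) \<Rightarrow> ('o \<Rightarrow> 'o) \<Rightarrow> bool" where
  "contraction C \<phi> f \<longleftrightarrow>
    f \<in> Ob C \<rightarrow> Ob C \<and>
    (\<forall>t. t \<le> \<phi> t) \<and>
    (\<forall>t. \<phi> t = t \<longrightarrow> t = bot \<or> 1 \<le> t) \<and>
    (\<forall>x\<in>Ob C. \<forall>y\<in>Ob C. \<phi> (Hom C x y) \<le> Hom C (f x) (f y))"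

definition qfixpoint :: "('o, 'q::quantale) qcat \<Rightarrow> ('o \<Rightarrow> 'o) \<Rightarrow> 'o \<Rightarrow> bool" where
  "qfixpoint C f u \<longleftrightarrow> u \<in> Ob C \<and> qiso C (f u) u"

definition iter_presheaf :: "('o, 'q::quantale) qcat \<Rightarrow> ('o \<Rightarrow> 'o) \<Rightarrow> 'o \<Rightarrow> 'o \<Rightarrow> 'q" where
  "iter_presheaf C f x = (\<lambda>y. SUP N. INF n\<in>{N..}. Hom C y ((f ^^ n) x))"

definition iter_copresheaf :: "('o, 'q::quantale) qcat \<Rightarrow> ('o \<Rightarrow> 'o) \<Rightarrow> 'o \<Rightarrow> 'o \<Rightarrow> 'q" where
  "iter_copresheaf C f x = (\<lambda>y. SUP N. INF n\<in>{N..}. Hom C ((f ^^ n) x) y)"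

end

theory Submission
  imports Defs "HOL-Library.Liminf_Limsup"
begin

text \<open>Write \<open>x\<^sub>n = f\<^sup>n x\<close> and \<open>C(y,z)\<close> for the homs, read as generalised distances with the order
  reversed, so that \<open>1 \<le> C(y,z)\<close> means that the distance from \<open>y\<close> to \<open>z\<close> vanishes and \<open>bot\<close> means
  that it is infinite. The proof is that of the Boyd--Wong fixpoint theorem in this reading.

  Every limit argument has the same source: if a sequence \<open>t\<close> satisfies
  \<open>\<phi> (t n) \<le> s n\<close> and \<open>liminf s \<le> liminf t\<close>, then lower-semicontinuity makes
  \<open>liminf t\<close> a fixpoint of the control function \<open>\<phi>\<close>, so it is \<open>bot\<close> or at least \<open>1\<close>. Applied to
  \<open>t n = C(x\<^sub>n, x\<^sub>n\<^sub>+\<^sub>1)\<close> and its mirror image, both nonzero and increasing, this says that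
  consecutive iterates become arbitrarily close.

  That the orbit is Cauchy is shown by contradiction. In a continuous lattice, \<open>1 \<le> liminf t\<close>
  means that every \<open>\<epsilon> \<lless> 1\<close> is eventually below \<open>t\<close>. If some \<open>\<epsilon> \<lless> 1\<close> fails to be below
  \<open>C(x\<^sub>m, x\<^sub>n)\<close> for arbitrarily large \<open>m \<le> n\<close>, choose for each \<open>k\<close> such a pair beyond \<open>k\<close> with \<open>n\<close>
  minimal. Minimality puts \<open>\<epsilon>\<close> below \<open>C(x\<^sub>m, x\<^sub>n\<^sub>-\<^sub>1)\<close>, and as the last step costs nothing in the limit,
  \<open>\<epsilon>\<close> is below the lower limit of the chosen homs \<open>C(x\<^sub>m, x\<^sub>n)\<close>. Since steps cost nothing, the homs
  \<open>C(x\<^sub>m\<^sub>+\<^sub>1, x\<^sub>n\<^sub>+\<^sub>1)\<close> have no larger lower limit, so the principle above applies: the lower limit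
  of the chosen homs is at least \<open>1\<close>, whence \<open>\<epsilon>\<close> lies below some of them, contrary to their choice.
  The homs \<open>C(x\<^sub>n, x\<^sub>m)\<close> are treated in the same way.

  A Cauchy orbit yields the adjunction, Cauchy-completeness an object \<open>u\<close> representing it, and
  \<open>u\<close> is a limit of the orbit. Since \<open>f\<close> does not decrease homs, \<open>f u\<close> is a limit
  as well, hence isomorphic to \<open>u\<close>.\<close>

section \<open>Lower limits in quantales and continuous lattices\<close>

lemma quantale_mult_mono:
  fixes a b c d :: "'q::quantale"
  assumes "a \<le> b" "c \<le> d"
  shows "a * c \<le> b * d"
proof -
  have "b * c = Sup ((\<lambda>s. s * c) ` {a, b})"
    using Sup_mult_distrib[of "{a, b}" c] assms(1) by (simp add: sup_absorb2)
  then have "a * c \<le> b * c" by (metis Sup_upper image_eqI insertI1)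
  moreover have "b * d = Sup ((\<lambda>s. b * s) ` {c, d})"
    using mult_Sup_distrib[of b "{c, d}"] assms(2) by (simp add: sup_absorb2)
  then have "b * c \<le> b * d" by (metis Sup_upper image_eqI insertI1)
  ultimately show ?thesis by (rule order_trans)
qed

lemma SUP_mult_SUP_le:
  fixes s :: "'i \<Rightarrow> 'q::quantale" and t :: "'j \<Rightarrow> 'q"
  assumes "\<And>i j. i \<in> I \<Longrightarrow> j \<in> J \<Longrightarrow> s i * t j \<le> c"
  shows "(SUP i\<in>I. s i) * (SUP j\<in>J. t j) \<le> c"
  using assms by (auto simp: Sup_mult_distrib mult_Sup_distrib intro!: SUP_least)

lemma Liminf_mult_le:
  fixes s t :: "'a \<Rightarrow> 'q::quantale"
  shows "Liminf F s * Liminf F t \<le> Liminf F (\<lambda>n. s n * t n)"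
  unfolding Liminf_def[of F s] Liminf_def[of F t]
proof (rule SUP_mult_SUP_le)
  fix P R
  assume "P \<in> {P. eventually P F}" "R \<in> {P. eventually P F}"
  then have "eventually (\<lambda>n. P n \<and> R n) F" by (auto intro: eventually_conj)
  then show "(INF n\<in>Collect P. s n) * (INF n\<in>Collect R. t n) \<le> Liminf F (\<lambda>n. s n * t n)"
    by (intro Liminf_bounded) (auto elim!: eventually_mono intro!: quantale_mult_mono INF_lower)
qed

lemma mult_Liminf_le:
  fixes c :: "'q::quantale"
  assumes "F \<noteq> bot"
  shows "c * Liminf F t \<le> Liminf F (\<lambda>n. c * t n)"
  using Liminf_mult_le[of F "\<lambda>_. c" t] Liminf_const[OF assms, of c] by simp

lemma Liminf_mult_right_le:
  fixes c :: "'q::quantale"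
  assumes "F \<noteq> bot"
  shows "Liminf F t * c \<le> Liminf F (\<lambda>n. t n * c)"
  using Liminf_mult_le[of F t "\<lambda>_. c"] Liminf_const[OF assms, of c] by simp

lemma Liminf_le_Liminf_comp:
  assumes "filterlim p F G"
  shows "Liminf F t \<le> Liminf G (\<lambda>n. t (p n))"
  by (rule Liminf_least)
    (use assms in \<open>auto simp: filterlim_iff intro!: Liminf_bounded INF_lower elim!: eventually_mono\<close>)

lemma liminf_Suc_le:
  fixes t :: "nat \<Rightarrow> 'a::complete_lattice"
  shows "liminf (\<lambda>n. t (Suc n)) \<le> liminf t"
  unfolding liminf_SUP_INF
proof (rule SUP_least)
  fix N :: nat
  have "(INF n\<in>{N..}. t (Suc n)) \<le> (INF n\<in>{Suc N..}. t n)"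
    by (rule INF_greatest) (auto simp: Suc_le_eq dest!: less_imp_Suc_add intro!: INF_lower)
  also have "\<dots> \<le> (SUP M. INF n\<in>{M..}. t n)" by (rule SUP_upper) simp
  finally show "(INF n\<in>{N..}. t (Suc n)) \<le> (SUP M. INF n\<in>{M..}. t n)" .
qed

lemma way_below_imp_le:
  "way_below a b \<Longrightarrow> a \<le> b"
  unfolding way_below_def directed_def by (drule spec[of _ "{b}"]) auto

text \<open>This replaces the \<open>\<epsilon>\<close>-characterisation of lower limits that is familiar from linear orders.
  The infima over the sets of a filter form a directed family, which gives the direction from
  left to right; continuity of the lattice gives the converse.\<close>

lemma le_Liminf_iff_way_below:
  fixes b :: "'q::continuous_lattice"
  shows "b \<le> Liminf F t \<longleftrightarrow> (\<forall>u. way_below u b \<longrightarrow> (\<forall>\<^sub>F n in F. u \<le> t n))"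
proof
  assume b: "b \<le> Liminf F t"
  show "\<forall>u. way_below u b \<longrightarrow> (\<forall>\<^sub>F n in F. u \<le> t n)"
  proof (intro allI impI)
    fix u assume u: "way_below u b"
    let ?D = "(\<lambda>P. INF n\<in>Collect P. t n) ` {P. eventually P F}"
    have "directed ?D"
      unfolding directed_def
    proof (intro conjI ballI)
      show "?D \<noteq> {}" using eventually_True by blast
      fix c d assume "c \<in> ?D" "d \<in> ?D"
      then obtain P R where "eventually P F" "eventually R F"
        and "c = (INF n\<in>Collect P. t n)" "d = (INF n\<in>Collect R. t n)"
        by auto
      then show "\<exists>e\<in>?D. c \<le> e \<and> d \<le> e"
        by (intro bexI[of _ "INF n\<in>{n. P n \<and> R n}. t n"])
          (auto intro: eventually_conj intro!: INF_superset_mono)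
    qed
    then obtain P where "eventually P F" "u \<le> (INF n\<in>Collect P. t n)"
      using u b unfolding way_below_def Liminf_def by blast
    then show "\<forall>\<^sub>F n in F. u \<le> t n"
      by (auto simp: le_INF_iff elim!: eventually_mono)
  qed
next
  assume "\<forall>u. way_below u b \<longrightarrow> (\<forall>\<^sub>F n in F. u \<le> t n)"
  then have "Sup {u. way_below u b} \<le> Liminf F t"
    by (intro Sup_least Liminf_bounded) blast
  then show "b \<le> Liminf F t" by (simp flip: Sup_way_below)
qed

section \<open>The orbit of a contraction\<close>

lemma iter_presheaf_eq_liminf: "iter_presheaf C f x y = liminf (\<lambda>n. Hom C y ((f ^^ n) x))"
  by (simp add: iter_presheaf_def liminf_SUP_INF)

lemma iter_copresheaf_eq_liminf: "iter_copresheaf C f x y = liminf (\<lambda>n. Hom C ((f ^^ n) x) y)"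
  by (simp add: iter_copresheaf_def liminf_SUP_INF)

text \<open>If a reflexive relation between indices fails for pairs \<open>m \<le> n\<close> beyond every bound, it
  fails beyond every \<open>k\<close> at a pair with minimal \<open>n\<close>. Writing that \<open>n\<close> as \<open>Suc (q k)\<close>
  is possible since reflexivity excludes \<open>m = n\<close>.\<close>

lemma minimal_violations:
  assumes refl: "\<And>m. R m m"
    and viol: "\<not> (\<exists>N. \<forall>m\<ge>N. \<forall>n\<ge>m. R m n)"
  obtains p q :: "nat \<Rightarrow> nat" where "filterlim p sequentially sequentially"
    and "filterlim q sequentially sequentially"
    and "\<And>k. R (p k) (q k)" "\<And>k. \<not> R (p k) (Suc (q k))"
proof -
  have "\<exists>m q. k \<le> m \<and> k \<le> q \<and> R m q \<and> \<not> R m (Suc q)" for k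
  proof -
    obtain m n where mn: "k \<le> m" "m \<le> n" "\<not> R m n" using viol by blast
    have "\<exists>q\<ge>m. R m q \<and> \<not> R m (Suc q)"
    proof (rule ccontr)
      assume *: "\<not> ?thesis"
      have "R m n" using mn(2) by (induction n rule: dec_induct) (use refl * in auto)
      with mn(3) show False ..
    qed
    with mn(1) show ?thesis by (meson order_trans)
  qed
  then obtain p q where pq: "\<And>k. k \<le> p k \<and> k \<le> q k \<and> R (p k) (q k) \<and> \<not> R (p k) (Suc (q k))"
    by metis
  then have "filterlim p sequentially sequentially" "filterlim q sequentially sequentially"
    by (auto intro: filterlim_at_top_mono[OF filterlim_ident])
  with pq that show thesis by blast
qed

locale contractive_orbit =
  fixes C :: "('o, 'q::{quantale, continuous_lattice}) qcat"
    and \<phi> :: "'q \<Rightarrow> 'q" and f :: "'o \<Rightarrow> 'o" and x :: 'o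
  assumes qcategory: "qcategory C"
    and contraction: "contraction C \<phi> f"
    and semicontinuous: "seq_lower_semicontinuous \<phi>"
    and start: "x \<in> Ob C"
    and forward_start: "Hom C x (f x) \<noteq> bot"
    and backward_start: "Hom C (f x) x \<noteq> bot"
begin

abbreviation iter :: "nat \<Rightarrow> 'o" where "iter n \<equiv> (f ^^ n) x"

lemma hom_comp:
  "\<lbrakk>a \<in> Ob C; b \<in> Ob C; c \<in> Ob C\<rbrakk> \<Longrightarrow> Hom C a b * Hom C b c \<le> Hom C a c"
  using qcategory by (simp add: qcategory_def)

lemma hom_id: "a \<in> Ob C \<Longrightarrow> 1 \<le> Hom C a a"
  using qcategory by (simp add: qcategory_def)

lemma f_closed [simp]: "a \<in> Ob C \<Longrightarrow> f a \<in> Ob C"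
  using contraction by (auto simp: contraction_def)

lemma iter_closed [simp]: "iter n \<in> Ob C"
  by (induction n) (auto simp: start f_closed)

lemma hom_contract: "\<lbrakk>a \<in> Ob C; b \<in> Ob C\<rbrakk> \<Longrightarrow> \<phi> (Hom C a b) \<le> Hom C (f a) (f b)"
  using contraction by (simp add: contraction_def)

lemma hom_f_mono: "\<lbrakk>a \<in> Ob C; b \<in> Ob C\<rbrakk> \<Longrightarrow> Hom C a b \<le> Hom C (f a) (f b)"
  using contraction hom_contract by (meson contraction_def order_trans)

text \<open>Lower-semicontinuity gives \<open>\<phi> (liminf t) \<le> liminf s \<le> liminf t\<close>, so \<open>liminf t\<close> is a fixpoint
  of the control function.\<close>

lemma liminf_zero_one:
  assumes "\<And>n. \<phi> (t n) \<le> s n" and "liminf s \<le> liminf t" and "liminf t \<noteq> bot"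
  shows "1 \<le> liminf t"
proof -
  have "\<phi> (liminf t) \<le> liminf (\<lambda>n. \<phi> (t n))"
    using semicontinuous by (simp add: seq_lower_semicontinuous_def liminf_SUP_INF)
  also have "\<dots> \<le> liminf s" by (rule Liminf_mono) (simp add: assms(1))
  also have "\<dots> \<le> liminf t" by (rule assms(2))
  finally have "\<phi> (liminf t) = liminf t"
    using contraction by (auto simp: contraction_def intro: antisym)
  then show ?thesis using contraction assms(3) by (auto simp: contraction_def)
qed

text \<open>For a sequence that grows at each step at least as \<open>\<phi>\<close> prescribes, \<open>liminf_zero_one\<close> applies
  to the sequence and its shift, which have the same lower limit.\<close>

lemma one_le_liminf_iterated:
  assumes step: "\<And>n. \<phi> (t n) \<le> t (Suc n)" and "t 0 \<noteq> bot"
  shows "1 \<le> liminf t"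
proof (rule liminf_zero_one[OF step])
  have "t n \<le> \<phi> (t n)" for n using contraction by (simp add: contraction_def)
  then have incr: "t n \<le> t (Suc n)" for n using step order_trans by blast
  show "liminf (\<lambda>n. t (Suc n)) \<le> liminf t" by (rule liminf_Suc_le)
  have "t 0 \<le> liminf t"
    using incr by (intro Liminf_bounded always_eventually) (auto intro: lift_Suc_mono_le)
  then show "liminf t \<noteq> bot" using assms(2) by (auto simp: bot_unique)
qed

lemma forward_steps: "1 \<le> liminf (\<lambda>n. Hom C (iter n) (iter (Suc n)))"
  by (rule one_le_liminf_iterated)
    (use hom_contract[of "iter _" "iter (Suc _)"] forward_start in auto)

lemma backward_steps: "1 \<le> liminf (\<lambda>n. Hom C (iter (Suc n)) (iter n))"
  by (rule one_le_liminf_iterated)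
    (use hom_contract[of "iter (Suc _)" "iter _"] backward_start in auto)

lemma forward_steps_comp:
  "filterlim p sequentially sequentially \<Longrightarrow>
    1 \<le> liminf (\<lambda>k. Hom C (iter (p k)) (iter (Suc (p k))))"
  using forward_steps Liminf_le_Liminf_comp by (rule order_trans)

lemma backward_steps_comp:
  "filterlim p sequentially sequentially \<Longrightarrow>
    1 \<le> liminf (\<lambda>k. Hom C (iter (Suc (p k))) (iter (p k)))"
  using backward_steps Liminf_le_Liminf_comp by (rule order_trans)

text \<open>Going from \<open>iter (p k)\<close> one step ahead, across and one step back to \<open>iter (q k)\<close> costs nothing
  in the limit, so the homs between next iterates have no larger lower limit than
  those between the iterates themselves, and \<open>liminf_zero_one\<close> applies.\<close>

lemma liminf_hom_zero_one:
  assumes p: "filterlim p sequentially sequentially"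
    and q: "filterlim q sequentially sequentially"
    and nz: "liminf (\<lambda>k. Hom C (iter (p k)) (iter (q k))) \<noteq> bot"
  shows "1 \<le> liminf (\<lambda>k. Hom C (iter (p k)) (iter (q k)))"
proof (rule liminf_zero_one[OF _ _ nz])
  let ?a = "\<lambda>k. Hom C (iter (p k)) (iter (Suc (p k)))"
  let ?s = "\<lambda>k. Hom C (iter (Suc (p k))) (iter (Suc (q k)))"
  let ?b = "\<lambda>k. Hom C (iter (Suc (q k))) (iter (q k))"
  show "\<phi> (Hom C (iter (p k)) (iter (q k))) \<le> ?s k" for k
    using hom_contract[of "iter (p k)" "iter (q k)"] by simp
  have "liminf ?s = 1 * liminf ?s * 1" by simp
  also have "\<dots> \<le> liminf ?a * liminf ?s * liminf ?b"
    by (intro quantale_mult_mono forward_steps_comp backward_steps_comp p q order_refl)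
  also have "\<dots> \<le> liminf (\<lambda>k. ?a k * ?s k) * liminf ?b"
    by (intro quantale_mult_mono Liminf_mult_le order_refl)
  also have "\<dots> \<le> liminf (\<lambda>k. ?a k * ?s k * ?b k)"
    by (rule Liminf_mult_le)
  also have "\<dots> \<le> liminf (\<lambda>k. Hom C (iter (p k)) (iter (q k)))"
  proof (intro Liminf_mono always_eventually allI)
    fix k
    have "?a k * ?s k * ?b k \<le> Hom C (iter (p k)) (iter (Suc (q k))) * ?b k"
      by (intro quantale_mult_mono hom_comp iter_closed order_refl)
    also have "\<dots> \<le> Hom C (iter (p k)) (iter (q k))"
      by (intro hom_comp iter_closed)
    finally show "?a k * ?s k * ?b k \<le> Hom C (iter (p k)) (iter (q k))" .
  qed
  finally show "liminf ?s \<le> liminf (\<lambda>k. Hom C (iter (p k)) (iter (q k)))" .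
qed

text \<open>A positive lower bound on the lower limit is thus improved to \<open>1\<close>, so that every
  \<open>\<epsilon> \<lless> 1\<close> is eventually a bound.\<close>

lemma way_below_one_attained:
  assumes "way_below \<epsilon> 1"
    and "filterlim p sequentially sequentially" "filterlim q sequentially sequentially"
    and le: "\<epsilon> \<le> liminf (\<lambda>k. Hom C (iter (p k)) (iter (q k)))"
  shows "\<exists>k. \<epsilon> \<le> Hom C (iter (p k)) (iter (q k))"
proof (cases "\<epsilon> = bot")
  case False
  then have "1 \<le> liminf (\<lambda>k. Hom C (iter (p k)) (iter (q k)))"
    using le by (intro liminf_hom_zero_one assms) (auto simp: bot_unique)
  then have "\<forall>\<^sub>F k in sequentially. \<epsilon> \<le> Hom C (iter (p k)) (iter (q k))"
    using assms(1) by (simp add: le_Liminf_iff_way_below)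
  then show ?thesis by (auto simp: eventually_sequentially)
qed simp

lemma forward_Cauchy:
  assumes \<epsilon>: "way_below \<epsilon> 1"
  shows "\<exists>N. \<forall>m\<ge>N. \<forall>n\<ge>m. \<epsilon> \<le> Hom C (iter m) (iter n)"
proof (rule ccontr)
  assume "\<not> ?thesis"
  then obtain p q where p: "filterlim p sequentially sequentially"
    and q: "filterlim q sequentially sequentially"
    and pq: "\<And>k. \<epsilon> \<le> Hom C (iter (p k)) (iter (q k))"
      "\<And>k. \<not> \<epsilon> \<le> Hom C (iter (p k)) (iter (Suc (q k)))"
    by (rule minimal_violations[rotated])
      (use order_trans[OF way_below_imp_le[OF \<epsilon>] hom_id] in auto)
  let ?a = "\<lambda>k. Hom C (iter (q k)) (iter (Suc (q k)))"
  have "\<epsilon> * 1 \<le> \<epsilon> * liminf ?a"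
    by (intro quantale_mult_mono forward_steps_comp q order_refl)
  also have "\<dots> \<le> liminf (\<lambda>k. \<epsilon> * ?a k)" by (rule mult_Liminf_le) simp
  also have "\<dots> \<le> liminf (\<lambda>k. Hom C (iter (p k)) (iter (Suc (q k))))"
  proof (intro Liminf_mono always_eventually allI)
    fix k
    have "\<epsilon> * ?a k \<le> Hom C (iter (p k)) (iter (q k)) * ?a k"
      by (intro quantale_mult_mono pq order_refl)
    also have "\<dots> \<le> Hom C (iter (p k)) (iter (Suc (q k)))"
      by (intro hom_comp iter_closed)
    finally show "\<epsilon> * ?a k \<le> Hom C (iter (p k)) (iter (Suc (q k)))" .
  qed
  finally have "\<epsilon> \<le> liminf (\<lambda>k. Hom C (iter (p k)) (iter (Suc (q k))))" by simp
  then have "\<exists>k. \<epsilon> \<le> Hom C (iter (p k)) (iter (Suc (q k)))"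
    by (intro way_below_one_attained \<epsilon> p filterlim_compose[OF filterlim_Suc q])
  with pq(2) show False by blast
qed

lemma backward_Cauchy:
  assumes \<epsilon>: "way_below \<epsilon> 1"
  shows "\<exists>N. \<forall>m\<ge>N. \<forall>n\<ge>m. \<epsilon> \<le> Hom C (iter n) (iter m)"
proof (rule ccontr)
  assume "\<not> ?thesis"
  then obtain p q where p: "filterlim p sequentially sequentially"
    and q: "filterlim q sequentially sequentially"
    and pq: "\<And>k. \<epsilon> \<le> Hom C (iter (q k)) (iter (p k))"
      "\<And>k. \<not> \<epsilon> \<le> Hom C (iter (Suc (q k))) (iter (p k))"
    by (rule minimal_violations[rotated])
      (use order_trans[OF way_below_imp_le[OF \<epsilon>] hom_id] in auto)
  let ?b = "\<lambda>k. Hom C (iter (Suc (q k))) (iter (q k))"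
  have "1 * \<epsilon> \<le> liminf ?b * \<epsilon>"
    by (intro quantale_mult_mono backward_steps_comp q order_refl)
  also have "\<dots> \<le> liminf (\<lambda>k. ?b k * \<epsilon>)" by (rule Liminf_mult_right_le) simp
  also have "\<dots> \<le> liminf (\<lambda>k. Hom C (iter (Suc (q k))) (iter (p k)))"
  proof (intro Liminf_mono always_eventually allI)
    fix k
    have "?b k * \<epsilon> \<le> ?b k * Hom C (iter (q k)) (iter (p k))"
      by (intro quantale_mult_mono pq order_refl)
    also have "\<dots> \<le> Hom C (iter (Suc (q k))) (iter (p k))"
      by (intro hom_comp iter_closed)
    finally show "?b k * \<epsilon> \<le> Hom C (iter (Suc (q k))) (iter (p k))" .
  qed
  finally have "\<epsilon> \<le> liminf (\<lambda>k. Hom C (iter (Suc (q k))) (iter (p k)))" by simp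
  then have "\<exists>k. \<epsilon> \<le> Hom C (iter (Suc (q k))) (iter (p k))"
    by (intro way_below_one_attained \<epsilon> p filterlim_compose[OF filterlim_Suc q])
  with pq(2) show False by blast
qed

lemma orbit_Cauchy:
  assumes "way_below \<epsilon> 1"
  shows "\<exists>N. \<forall>m\<ge>N. \<forall>n\<ge>N. \<epsilon> \<le> Hom C (iter m) (iter n)"
proof -
  obtain N M where "\<forall>m\<ge>N. \<forall>n\<ge>m. \<epsilon> \<le> Hom C (iter m) (iter n)"
    and "\<forall>m\<ge>M. \<forall>n\<ge>m. \<epsilon> \<le> Hom C (iter n) (iter m)"
    using forward_Cauchy[OF assms] backward_Cauchy[OF assms] by blast
  then show ?thesis by (intro exI[of _ "max N M"]) (metis max.bounded_iff nat_le_linear)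
qed

section \<open>The adjunction and the fixpoint\<close>

lemma one_le_liminf_iter_presheaf: "1 \<le> liminf (\<lambda>k. iter_presheaf C f x (iter k))"
  unfolding le_Liminf_iff_way_below
proof (intro allI impI)
  fix \<epsilon> :: 'q assume "way_below \<epsilon> 1"
  then obtain N where "\<forall>m\<ge>N. \<forall>n\<ge>N. \<epsilon> \<le> Hom C (iter m) (iter n)" using orbit_Cauchy by blast
  then show "\<forall>\<^sub>F k in sequentially. \<epsilon> \<le> iter_presheaf C f x (iter k)"
    unfolding iter_presheaf_eq_liminf
    by (intro eventually_sequentiallyI[of N] Liminf_bounded) auto
qed

lemma one_le_liminf_iter_copresheaf: "1 \<le> liminf (\<lambda>k. iter_copresheaf C f x (iter k))"
  unfolding le_Liminf_iff_way_below
proof (intro allI impI)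
  fix \<epsilon> :: 'q assume "way_below \<epsilon> 1"
  then obtain N where "\<forall>m\<ge>N. \<forall>n\<ge>N. \<epsilon> \<le> Hom C (iter m) (iter n)" using orbit_Cauchy by blast
  then show "\<forall>\<^sub>F k in sequentially. \<epsilon> \<le> iter_copresheaf C f x (iter k)"
    unfolding iter_copresheaf_eq_liminf
    by (intro eventually_sequentiallyI[of N] Liminf_bounded) auto
qed

text \<open>The unit of the adjunction is the Cauchy property: along the orbit, both distributors
  have lower limit at least \<open>1\<close>, hence so has their product. The other parts are composition of
  homs under a lower limit.\<close>

lemma iter_adjunction: "left_adjoint_to C (iter_presheaf C f x) (iter_copresheaf C f x)"
  unfolding left_adjoint_to_def
proof (intro conjI ballI)
  let ?P = "iter_presheaf C f x" and ?S = "iter_copresheaf C f x"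
  show "presheaf C ?P"
    unfolding presheaf_def iter_presheaf_eq_liminf
    by (intro ballI order_trans[OF mult_Liminf_le] Liminf_mono always_eventually allI hom_comp
        iter_closed) simp_all
  show "copresheaf C ?S"
    unfolding copresheaf_def iter_copresheaf_eq_liminf
    by (intro ballI order_trans[OF Liminf_mult_right_le] Liminf_mono always_eventually allI
        hom_comp iter_closed) simp_all
  have "1 * 1 \<le> liminf (\<lambda>k. ?S (iter k)) * liminf (\<lambda>k. ?P (iter k))"
    by (intro quantale_mult_mono one_le_liminf_iter_presheaf one_le_liminf_iter_copresheaf)
  also have "\<dots> \<le> liminf (\<lambda>k. ?S (iter k) * ?P (iter k))" by (rule Liminf_mult_le)
  also have "\<dots> \<le> liminf (\<lambda>k::nat. SUP y\<in>Ob C. ?S y * ?P y)"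
    by (intro Liminf_mono always_eventually allI SUP_upper iter_closed)
  also have "\<dots> = (SUP y\<in>Ob C. ?S y * ?P y)" by (rule Liminf_const) simp
  finally show "1 \<le> (SUP y\<in>Ob C. ?S y * ?P y)" by simp
  fix y y' assume y: "y \<in> Ob C" "y' \<in> Ob C"
  have "?P y * ?S y' \<le> liminf (\<lambda>n. Hom C y (iter n) * Hom C (iter n) y')"
    unfolding iter_presheaf_eq_liminf iter_copresheaf_eq_liminf by (rule Liminf_mult_le)
  also have "\<dots> \<le> liminf (\<lambda>n::nat. Hom C y y')"
    by (intro Liminf_mono always_eventually allI hom_comp iter_closed y)
  also have "\<dots> = Hom C y y'" by (rule Liminf_const) simp
  finally show "?P y * ?S y' \<le> Hom C y y'" .
qed

text \<open>Uniqueness of right adjoints, for the representable presheaf of \<open>u\<close>.\<close>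

lemma right_adjoint_corepresented:
  assumes adj: "left_adjoint_to C P S" and rep: "represents C u P"
  shows "corepresents C u S"
  unfolding corepresents_def
proof (intro conjI ballI antisym)
  show u: "u \<in> Ob C" using rep by (simp add: represents_def)
  have P: "P z = Hom C z u" if "z \<in> Ob C" for z using rep that by (simp add: represents_def)
  fix y assume y: "y \<in> Ob C"
  have "1 * S y \<le> P u * S y" using hom_id[OF u] P[OF u] by (intro quantale_mult_mono) auto
  also have "\<dots> \<le> Hom C u y" using adj u y by (simp add: left_adjoint_to_def)
  finally show "S y \<le> Hom C u y" by simp
  have "S z * P z \<le> S u" if "z \<in> Ob C" for z
    using adj u that by (simp add: left_adjoint_to_def copresheaf_def P)
  then have "(SUP z\<in>Ob C. S z * P z) \<le> S u" by (rule SUP_least)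
  then have "1 \<le> S u" using adj by (auto simp: left_adjoint_to_def intro: order_trans)
  then have "1 * Hom C u y \<le> S u * Hom C u y" by (intro quantale_mult_mono order_refl)
  also have "\<dots> \<le> S y" using adj u y by (simp add: left_adjoint_to_def copresheaf_def)
  finally show "Hom C u y \<le> S y" by simp
qed

text \<open>Representability at \<open>u\<close> itself says that the homs between \<open>u\<close> and \<open>iter n\<close> tend to at least \<open>1\<close>
  in both directions. The homs between \<open>f u\<close> and \<open>iter (Suc n)\<close> are no smaller, so the value of
  either distributor at \<open>f u\<close> is at least \<open>1\<close> too.\<close>

lemma representing_object_fixpoint:
  assumes P: "represents C u (iter_presheaf C f x)"
    and S: "corepresents C u (iter_copresheaf C f x)"
  shows "qfixpoint C f u"
proof -
  have u: "u \<in> Ob C" using P by (simp add: represents_def)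
  note fu = f_closed[OF u]
  have "1 \<le> liminf (\<lambda>n. Hom C u (iter n))"
    using P hom_id[OF u] u by (simp add: represents_def flip: iter_presheaf_eq_liminf)
  also have "\<dots> \<le> liminf (\<lambda>n. Hom C (f u) (iter (Suc n)))"
    using hom_f_mono[OF u iter_closed] by (intro Liminf_mono) simp
  also have "\<dots> \<le> liminf (\<lambda>n. Hom C (f u) (iter n))" by (rule liminf_Suc_le)
  also have "\<dots> = Hom C (f u) u"
    using P fu by (simp add: represents_def flip: iter_presheaf_eq_liminf)
  finally have to_u: "1 \<le> Hom C (f u) u" .
  have "1 \<le> liminf (\<lambda>n. Hom C (iter n) u)"
    using S hom_id[OF u] u by (simp add: corepresents_def flip: iter_copresheaf_eq_liminf)
  also have "\<dots> \<le> liminf (\<lambda>n. Hom C (iter (Suc n)) (f u))"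
    using hom_f_mono[OF iter_closed u] by (intro Liminf_mono) simp
  also have "\<dots> \<le> liminf (\<lambda>n. Hom C (iter n) (f u))" by (rule liminf_Suc_le)
  also have "\<dots> = Hom C u (f u)"
    using S fu by (simp add: corepresents_def flip: iter_copresheaf_eq_liminf)
  finally show ?thesis using to_u u fu by (simp add: qfixpoint_def qiso_def)
qed

end

theorem theorem2p3p2:
  fixes C :: "('o, 'q::{quantale, continuous_lattice}) qcat"
    and \<phi> :: "'q \<Rightarrow> 'q"
    and f :: "'o \<Rightarrow> 'o"
    and x :: 'o
  assumes "qcategory C"
    and "Cauchy_complete_qcat C"
    and "contraction C \<phi> f"
    and "seq_lower_semicontinuous \<phi>"
    and "x \<in> Ob C"
    and "Hom C x (f x) \<noteq> bot"
    and "Hom C (f x) x \<noteq> bot"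
  shows "left_adjoint_to C (iter_presheaf C f x) (iter_copresheaf C f x) \<and>
    (\<exists>u\<in>Ob C. represents C u (iter_presheaf C f x) \<and>
       corepresents C u (iter_copresheaf C f x) \<and> qfixpoint C f u) \<and>
    (\<forall>u\<in>Ob C. represents C u (iter_presheaf C f x) \<and>
       corepresents C u (iter_copresheaf C f x) \<longrightarrow> qfixpoint C f u)"
proof -
  interpret contractive_orbit C \<phi> f x
    using assms by unfold_locales
  obtain u where u: "represents C u (iter_presheaf C f x)"
    using assms(2) iter_adjunction by (auto simp: Cauchy_complete_qcat_def)
  then have "corepresents C u (iter_copresheaf C f x)"
    by (rule right_adjoint_corepresented[OF iter_adjunction])
  then show ?thesis
    using u iter_adjunction representing_object_fixpoint
    by (auto simp: represents_def)
qed

end
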